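(* Let $g:\mathbb{N}\setminus\{0\}\to\mathbb{N}\setminus\{0\}$ be a non-decreasing function which majorizes $f$, i.e. $f(n)\le g(n)$ for every positive integer $n$. Then a finite-fold Diophantine representation of $g$ does not exist.
   Context: $\mathbb{N}$ denotes the set of non-negative integers. For a positive integer $n$, let $E_n=\{x_i=1,\ x_i+x_j=x_k,\ x_i\cdot x_j=x_k : i,j,k\in\{1,\ldots,n\}\}$, a finite set of equations in the variables $x_1,\ldots,x_n$ (the indices $i,j,k$ need not be distinct). A subsystem of $E_n$ is a subset $S\subseteq E_n$; its solutions are the tuples $(x_1,\ldots,x_n)\in\mathbb{Z}^n$ satisfying all equations in $S$. For a positive integer $n$, $f(n)$ denotes the greatest finite total number of solutions of a subsystem of $E_n$ in integers $x_1,\ldots,x_n$, i.e. the maximum of the number of integer solutions over all subsystems $S\subseteq E_n$ that have only finitely many integer solutions. A Diophantine representation of a set $\mathcal{M}\subseteq\mathbb{N}^k$ is given by an integer $m\ge 0$ and a polynomial $W(a_1,\ldots,a_k,x_1,\ldots,x_m)$ with integer coefficients such that for all $a_1,\ldots,a_k\in\mathbb{N}$: $(a_1,\ldots,a_k)\in\mathcal{M}$ if and only if there exist $x_1,\ldots,x_m\in\mathbb{N}$ with $W(a_1,\ldots,a_k,x_1,\ldots,x_m)=0$. The representation is finite-fold if for all $a_1,\ldots,a_k\in\mathbb{N}$ the equation $W(a_1,\ldots,a_k,x_1,\ldots,x_m)=0$ has only finitely many solutions $(x_1,\ldots,x_m)\in\mathbb{N}^m$. A (finite-fold) Diophantine representation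 of a function $g:\mathbb{N}\setminus\{0\}\to\mathbb{N}\setminus\{0\}$ means one of its graph $\{(n,g(n)) : n\in\mathbb{N}\setminus\{0\}\}\subseteq\mathbb{N}^2$. *)

theory Defs
  imports Complex_Main "HOL-Library.Poly_Mapping" "HOL-Library.FuncSet"
begin

text \<open>
  Formal equations: \<open>One i\<close> stands for $x_i = 1$, \<open>Add i j k\<close> for $x_i + x_j = x_k$ and
  \<open>Mult i j k\<close> for $x_i \cdot x_j = x_k$.
\<close>

datatype equation = One nat | Add nat nat nat | Mult nat nat nat

fun satisfies :: "(nat \<Rightarrow> int) \<Rightarrow> equation \<Rightarrow> bool" where
  "satisfies x (One i) \<longleftrightarrow> x i = 1"
| "satisfies x (Add i j k) \<longleftrightarrow> x i + x j = x k"
| "satisfies x (Mult i j k) \<longleftrightarrow> x i * x j = x k"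

definition E :: "nat \<Rightarrow> equation set" where
  "E n = {One i |i. i \<in> {1..n}}
       \<union> {Add i j k |i j k. i \<in> {1..n} \<and> j \<in> {1..n} \<and> k \<in> {1..n}}
       \<union> {Mult i j k |i j k. i \<in> {1..n} \<and> j \<in> {1..n} \<and> k \<in> {1..n}}"

text \<open>
  Integer tuples $(x_1, \ldots, x_n)$ are extensional functions on \<open>{1..n}\<close>, so that
  distinct solutions are distinct as tuples and cardinalities count tuples.
\<close>

definition solutions :: "nat \<Rightarrow> equation set \<Rightarrow> (nat \<Rightarrow> int) set" where
  "solutions n S = {x \<in> {1..n} \<rightarrow>\<^sub>E UNIV. \<forall>e\<in>S. satisfies x e}"

definition finite_solution_counts :: "nat \<Rightarrow> nat set" where
  "finite_solution_counts n = {card (solutions n S) |S. S \<subseteq> E n \<and> finite (solutions n S)}"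

definition max_finite_solutions :: "nat \<Rightarrow> nat" where
  "max_finite_solutions n = Max (finite_solution_counts n)"

text \<open>The maximum is taken over a finite set, which is nonempty for positive \<open>n\<close>.\<close>

lemma finite_E: "finite (E n)"
proof -
  let ?I = "{1..n}"
  let ?B = "One ` ?I \<union> (\<lambda>(i, j, k). Add i j k) ` (?I \<times> ?I \<times> ?I)
    \<union> (\<lambda>(i, j, k). Mult i j k) ` (?I \<times> ?I \<times> ?I)"
  have "E n \<subseteq> ?B"
  proof
    fix e
    assume e: "e \<in> E n"
    show "e \<in> ?B"
    proof (cases e)
      case (One i)
      then show ?thesis
        using e by (simp add: E_def)
    next
      case (Add i j k)
      then have "(i, j, k) \<in> ?I \<times> ?I \<times> ?I"
        using e by (simp add: E_def)
      then have "(\<lambda>(i, j, k). Add i j k) (i, j, k) \<in> (\<lambda>(i, j, k). Add i j k) ` (?I \<times> ?I \<times> ?I)"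
        by (rule imageI)
      then show ?thesis
        unfolding Add prod.case by (rule UnI1[OF UnI2])
    next
      case (Mult i j k)
      then have "(i, j, k) \<in> ?I \<times> ?I \<times> ?I"
        using e by (simp add: E_def)
      then have "(\<lambda>(i, j, k). Mult i j k) (i, j, k) \<in> (\<lambda>(i, j, k). Mult i j k) ` (?I \<times> ?I \<times> ?I)"
        by (rule imageI)
      then show ?thesis
        unfolding Mult prod.case by (rule UnI2)
    qed
  qed
  moreover have "finite ?B"
    by (intro finite_UnI finite_imageI finite_cartesian_product finite_atLeastAtMost)
  ultimately show ?thesis
    by (rule finite_subset)
qed

lemma finite_finite_solution_counts: "finite (finite_solution_counts n)"
proof -
  have "finite_solution_counts n \<subseteq> (\<lambda>S. card (solutions n S)) ` Pow (E n)"
    unfolding finite_solution_counts_def by blast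
  then show ?thesis
    by (rule finite_subset) (simp add: finite_E)
qed

lemma finite_solution_counts_nonempty:
  assumes "n \<ge> 1"
  shows "finite_solution_counts n \<noteq> {}"
proof -
  have mem: "One 1 \<in> E n" "Add 1 1 1 \<in> E n"
    using assms by (auto simp: E_def)
  have "x \<notin> solutions n (E n)" for x
  proof
    assume "x \<in> solutions n (E n)"
    then have "satisfies x (One 1)" "satisfies x (Add 1 1 1)"
      using mem unfolding solutions_def by blast+
    then show False
      by simp
  qed
  then have "solutions n (E n) = {}"
    by blast
  then have "E n \<subseteq> E n \<and> finite (solutions n (E n))"
    by simp
  then show ?thesis
    unfolding finite_solution_counts_def by blast
qed

text \<open>
  Multivariate integer polynomials: finitely supported maps from exponent vectors
  (themselves finitely supported) to coefficients.
\<close>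

type_synonym int_mpoly = "(nat \<Rightarrow>\<^sub>0 nat) \<Rightarrow>\<^sub>0 int"

definition vars :: "int_mpoly \<Rightarrow> nat set" where
  "vars W = (\<Union>t\<in>Poly_Mapping.keys W. Poly_Mapping.keys t)"

definition eval_mpoly :: "int_mpoly \<Rightarrow> (nat \<Rightarrow> int) \<Rightarrow> int" where
  "eval_mpoly W v = (\<Sum>t\<in>Poly_Mapping.keys W. Poly_Mapping.lookup W t * (\<Prod>i\<in>Poly_Mapping.keys t. v i ^ Poly_Mapping.lookup t i))"

text \<open>
  Tuples over the natural numbers are lists. In $W(a_1,\ldots,a_k,x_1,\ldots,x_m)$ the
  variables of index \<open>0, \<dots>, k - 1\<close> are the parameters and those of index
  \<open>k, \<dots>, k + m - 1\<close> are the unknowns.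
\<close>

definition zeros :: "nat \<Rightarrow> int_mpoly \<Rightarrow> nat list \<Rightarrow> nat list set" where
  "zeros m W a = {x. length x = m \<and> eval_mpoly W (\<lambda>i. int ((a @ x) ! i)) = 0}"

definition diophantine_representation ::
    "nat \<Rightarrow> nat list set \<Rightarrow> nat \<Rightarrow> int_mpoly \<Rightarrow> bool" where
  "diophantine_representation k M m W \<longleftrightarrow>
     M \<subseteq> {a. length a = k} \<and> vars W \<subseteq> {..<k + m} \<and>
     (\<forall>a. length a = k \<longrightarrow> (a \<in> M \<longleftrightarrow> (\<exists>x. x \<in> zeros m W a)))"

definition finite_fold_representation ::
    "nat \<Rightarrow> nat list set \<Rightarrow> nat \<Rightarrow> int_mpoly \<Rightarrow> bool" where
  "finite_fold_representation k M m W \<longleftrightarrow>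
     diophantine_representation k M m W \<and>
     (\<forall>a. length a = k \<longrightarrow> finite (zeros m W a))"

text \<open>The graph of a function on the positive integers; the value at \<open>0\<close> is ignored.\<close>

definition graph_pos :: "(nat \<Rightarrow> nat) \<Rightarrow> nat list set" where
  "graph_pos g = {[n, g n] |n. n \<ge> 1}"

end

theory Submission
  imports Defs "HOL-Computational_Algebra.Primes"
begin

text \<open>
  Suppose $W(a, b, \vec x) = 0$ is a finite-fold representation of the graph of $g$. Put $a = 2^t$
  and $b = u + v$, and replace $u$, $v$ and the unknowns $x_i$ by sums of four integer squares. By
  Lagrange's theorem the resulting integer equation has finitely many solutions but more than
  $g(2^t)$ of them, since $u$ may be any of $0, \ldots, g(2^t)$. The constant $2^t$ takes only
  $O(t)$ arithmetic operations, so introducing a variable for every subterm yields an equivalent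
  subsystem of $E_N$ with $N = O(t)$ and equally many solutions. For $t$ large $N \le 2^t$,
  hence $g(2^t) < f(N) \le g(N) \le g(2^t)$.
\<close>

section \<open>Lagrange's four-square theorem\<close>

definition sum4sq :: "int \<Rightarrow> bool" where
  "sum4sq n \<longleftrightarrow> (\<exists>a b c d. n = a\<^sup>2 + b\<^sup>2 + c\<^sup>2 + d\<^sup>2)"

text \<open>Multiplicativity of the quaternion norm, with one factor conjugated. In this form the
  last three bases vanish when the two quadruples agree, so they are divisible by \<open>m\<close>
  when the quadruples are congruent modulo \<open>m\<close>, as the descent needs.\<close>

lemma euler_four_square:
  fixes a b c d x y z w :: int
  shows "(a\<^sup>2 + b\<^sup>2 + c\<^sup>2 + d\<^sup>2) * (x\<^sup>2 + y\<^sup>2 + z\<^sup>2 + w\<^sup>2) =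
    (a*x + b*y + c*z + d*w)\<^sup>2 + (a*y - b*x + c*w - d*z)\<^sup>2 +
    (a*z - b*w - c*x + d*y)\<^sup>2 + (a*w + b*z - c*y - d*x)\<^sup>2"
  by (simp add: power2_eq_square algebra_simps)

lemma sum4sq_mult: "sum4sq m \<Longrightarrow> sum4sq n \<Longrightarrow> sum4sq (m * n)"
  unfolding sum4sq_def using euler_four_square by metis

text \<open>Pigeonhole: on 0, ..., (p-1)/2 the values a^2 and the values -1-b^2 each give (p+1)/2
  distinct residues. Together these are p+1 residues, more than there are modulo \<open>p\<close>,
  so the two families meet.\<close>

lemma exists_sum2sq_plus_one_dvd:
  fixes p :: int
  assumes "prime p" "odd p"
  obtains a b where "p dvd a\<^sup>2 + b\<^sup>2 + 1" "0 \<le> a" "2 * a < p" "0 \<le> b" "2 * b < p"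
proof -
  define I where "I = {0..(p - 1) div 2}"
  have p: "p > 2" using assms prime_ge_2_int[of p] by (cases "p = 2") auto
  have inj: "inj_on (\<lambda>a. a\<^sup>2 mod p) I"
  proof (rule inj_onI)
    fix x y assume xy: "x \<in> I" "y \<in> I" "x\<^sup>2 mod p = y\<^sup>2 mod p"
    have "p dvd x\<^sup>2 - y\<^sup>2" using xy(3) by (simp add: mod_eq_dvd_iff)
    then have "p dvd (x - y) * (x + y)" by (simp add: algebra_simps power2_eq_square)
    then have "p dvd x - y \<or> p dvd x + y" using assms(1) prime_dvd_mult_iff by blast
    then show "x = y"
    proof
      assume "p dvd x - y"
      moreover have "\<bar>x - y\<bar> < p" using xy p unfolding I_def by auto
      ultimately show ?thesis using dvd_imp_le_int[of "x - y" p] by auto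
    next
      assume "p dvd x + y"
      moreover have "\<bar>x + y\<bar> < p" "x \<ge> 0" "y \<ge> 0" using xy p unfolding I_def by auto
      moreover from calculation have "x + y = 0" using dvd_imp_le_int[of "x + y" p] p by linarith
      ultimately show ?thesis by linarith
    qed
  qed
  have inj2: "inj_on (\<lambda>b. (- 1 - b\<^sup>2) mod p) I"
  proof (rule inj_onI)
    fix x y assume xy: "x \<in> I" "y \<in> I" "(- 1 - x\<^sup>2) mod p = (- 1 - y\<^sup>2) mod p"
    then have "y\<^sup>2 mod p = x\<^sup>2 mod p" by (simp add: mod_eq_dvd_iff)
    then show "x = y" using inj xy unfolding inj_on_def by metis
  qed
  let ?A = "(\<lambda>a. a\<^sup>2 mod p) ` I" and ?B = "(\<lambda>b. (- 1 - b\<^sup>2) mod p) ` I"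
  have cI: "int (card I) = (p - 1) div 2 + 1" using p unfolding I_def by simp
  have "?A \<inter> ?B \<noteq> {}"
  proof
    assume "?A \<inter> ?B = {}"
    then have "card (?A \<union> ?B) = card I + card I"
      using inj inj2 by (subst card_Un_disjoint) (auto simp: card_image I_def)
    moreover have "card (?A \<union> ?B) \<le> card {0..<p}"
      by (rule card_mono) (use p in auto)
    ultimately have "2 * int (card I) \<le> p" using p by simp
    then show False using cI assms(2) by (auto elim!: oddE)
  qed
  then obtain a b where ab: "a \<in> I" "b \<in> I" "a\<^sup>2 mod p = (- 1 - b\<^sup>2) mod p" by auto
  then have "p dvd a\<^sup>2 + b\<^sup>2 + 1" by (simp add: mod_eq_dvd_iff algebra_simps)
  moreover have "0 \<le> a" "2 * a < p" "0 \<le> b" "2 * b < p" using ab unfolding I_def by auto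
  ultimately show thesis using that by blast
qed

text \<open>The residue of least absolute value has square at most m^2/4, so four such squares add
  up to at most m^2.\<close>

lemma centered_residue:
  fixes x m :: int
  assumes "m > 0"
  obtains y k where "x = y + m * k" "2 * \<bar>y\<bar> \<le> m"
proof (cases "2 * (x mod m) \<le> m")
  case True
  have "x = x mod m + m * (x div m)" by simp
  moreover have "2 * \<bar>x mod m\<bar> \<le> m" using True assms by simp
  ultimately show thesis using that by blast
next
  case False
  have "x = (x mod m - m) + m * (x div m + 1)" by (simp add: algebra_simps)
  moreover have "\<bar>x mod m - m\<bar> = m - x mod m"
    using pos_mod_bound[OF assms, of x] by linarith
  then have "2 * \<bar>x mod m - m\<bar> \<le> m" using False by simp
  ultimately show thesis using that by blast
qed

text \<open>Reducing the four bases modulo \<open>m\<close> to centered residues gives a sum of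
  squares \<open>m * r\<close> with \<open>r \<le> m\<close>. Euler's identity writes
  \<open>(m * p) * (m * r)\<close> as four squares whose bases are all divisible by
  \<open>m\<close>; cancelling \<open>m * m\<close> leaves \<open>r * p\<close>. The extreme cases
  \<open>r = 0\<close> and \<open>r = m\<close> would make \<open>m\<close> a divisor of the prime
  \<open>p\<close>.\<close>

lemma sum4sq_descent:
  fixes m p :: int
  assumes p: "prime p" and m: "1 < m" "m < p" and "sum4sq (m * p)"
  shows "\<exists>r. 1 \<le> r \<and> r < m \<and> sum4sq (r * p)"
proof -
  have ndvd: "\<not> m dvd p" using p m by (smt (verit) prime_int_iff)
  have m0: "m > 0" using m(1) by simp
  from assms(4) obtain x1 x2 x3 x4 where X: "m * p = x1\<^sup>2 + x2\<^sup>2 + x3\<^sup>2 + x4\<^sup>2"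
    unfolding sum4sq_def by blast
  obtain y1 k1 where 1: "x1 = y1 + m * k1" "2 * \<bar>y1\<bar> \<le> m"
    using centered_residue[OF m0] .
  obtain y2 k2 where 2: "x2 = y2 + m * k2" "2 * \<bar>y2\<bar> \<le> m"
    using centered_residue[OF m0] .
  obtain y3 k3 where 3: "x3 = y3 + m * k3" "2 * \<bar>y3\<bar> \<le> m"
    using centered_residue[OF m0] .
  obtain y4 k4 where 4: "x4 = y4 + m * k4" "2 * \<bar>y4\<bar> \<le> m"
    using centered_residue[OF m0] .
  define q where "q = y1*k1 + y2*k2 + y3*k3 + y4*k4"
  define k where "k = k1\<^sup>2 + k2\<^sup>2 + k3\<^sup>2 + k4\<^sup>2"
  \<comment> \<open>Expanding the squares of y_i + m k_i turns m p into the sum of the y_i^2 plus 2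
    m q + m^2 k; solving for that sum gives \<open>m * r\<close>.\<close>
  define r where "r = p - 2 * q - m * k"
  have Y: "y1\<^sup>2 + y2\<^sup>2 + y3\<^sup>2 + y4\<^sup>2 = m * r"
    using X unfolding r_def q_def k_def 1(1) 2(1) 3(1) 4(1)
    by (simp add: power2_eq_square algebra_simps)
  have sq: "4 * y\<^sup>2 \<le> m\<^sup>2" if "2 * \<bar>y\<bar> \<le> m" for y
    using power_mono[OF that, of 2] by (simp add: power_mult_distrib)
  note sqs = sq[OF 1(2)] sq[OF 2(2)] sq[OF 3(2)] sq[OF 4(2)]
  have "m * r \<le> m * m" using sqs Y unfolding power2_eq_square by linarith
  then have "r \<le> m" using m by simp
  have "m * r \<ge> 0" unfolding Y[symmetric] by simp
  then have "r \<ge> 0" using m by (simp add: zero_le_mult_iff)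
  have "r \<noteq> 0"
  proof
    assume "r = 0"
    then have "y1\<^sup>2 + y2\<^sup>2 + y3\<^sup>2 + y4\<^sup>2 = 0" using Y by simp
    then have "y1 = 0 \<and> y2 = 0 \<and> y3 = 0 \<and> y4 = 0"
      by (smt (verit) zero_le_power2 zero_less_power2)
    then have "p = m * k" using \<open>r = 0\<close> by (simp add: r_def q_def)
    then show False using ndvd by simp
  qed
  \<comment> \<open>If \<open>r = m\<close>, then every \<open>2 * \<bar>y\<^sub>i\<bar>\<close> equals \<open>m\<close>, and \<open>m\<close> would divide \<open>p\<close>.\<close>
  have "r \<noteq> m"
  proof
    assume "r = m"
    then have "4 * y1\<^sup>2 = m\<^sup>2 \<and> 4 * y2\<^sup>2 = m\<^sup>2 \<and> 4 * y3\<^sup>2 = m\<^sup>2 \<and> 4 * y4\<^sup>2 = m\<^sup>2"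
      using sqs Y unfolding power2_eq_square by (intro conjI; simp)
    moreover have "m dvd 2 * y" if "4 * y\<^sup>2 = m\<^sup>2" for y
    proof -
      have "(2 * y)\<^sup>2 = m\<^sup>2" using that by (simp add: power_mult_distrib)
      then have "2 * y = m \<or> 2 * y = - m" by (simp only: power2_eq_iff)
      then show ?thesis by auto
    qed
    ultimately have "m dvd 2 * y1" "m dvd 2 * y2" "m dvd 2 * y3" "m dvd 2 * y4" by blast+
    then have "m dvd (2 * y1) * k1 + (2 * y2) * k2 + (2 * y3) * k3 + (2 * y4) * k4"
      by (intro dvd_add dvd_mult2[of m "2 * _"])
    then have "m dvd 2 * q" unfolding q_def by (simp add: algebra_simps)
    moreover have "p = 2 * q + m * (k + 1)" using \<open>r = m\<close> by (simp add: r_def algebra_simps)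
    ultimately show False using ndvd by simp
  qed
  have "m * m * (r * p) = (x1\<^sup>2 + x2\<^sup>2 + x3\<^sup>2 + x4\<^sup>2) * (y1\<^sup>2 + y2\<^sup>2 + y3\<^sup>2 + y4\<^sup>2)"
    unfolding Y X[symmetric] by simp
  also have "\<dots> = (m * (r + q))\<^sup>2 + (m * (k1*y2 - k2*y1 + k3*y4 - k4*y3))\<^sup>2 +
      (m * (k1*y3 - k2*y4 - k3*y1 + k4*y2))\<^sup>2 + (m * (k1*y4 + k2*y3 - k3*y2 - k4*y1))\<^sup>2"
  \<comment> \<open>After substituting x_i = y_i + m k_i, the terms free of \<open>m\<close> add up
    to \<open>m * r\<close> in the first base and cancel by antisymmetry in the other three.\<close>
  proof -
    have "x1*y1 + x2*y2 + x3*y3 + x4*y4 = m * (r + q)"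
      using Y unfolding 1(1) 2(1) 3(1) 4(1) q_def by (simp add: power2_eq_square algebra_simps)
    moreover have "x1*y2 - x2*y1 + x3*y4 - x4*y3 = m * (k1*y2 - k2*y1 + k3*y4 - k4*y3)"
      unfolding 1(1) 2(1) 3(1) 4(1) by (simp add: power2_eq_square algebra_simps)
    moreover have "x1*y3 - x2*y4 - x3*y1 + x4*y2 = m * (k1*y3 - k2*y4 - k3*y1 + k4*y2)"
      unfolding 1(1) 2(1) 3(1) 4(1) by (simp add: power2_eq_square algebra_simps)
    moreover have "x1*y4 + x2*y3 - x3*y2 - x4*y1 = m * (k1*y4 + k2*y3 - k3*y2 - k4*y1)"
      unfolding 1(1) 2(1) 3(1) 4(1) by (simp add: power2_eq_square algebra_simps)
    ultimately show ?thesis using euler_four_square[of x1 x2 x3 x4 y1 y2 y3 y4] by simp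
  qed
  also have "\<dots> = m * m * ((r + q)\<^sup>2 + (k1*y2 - k2*y1 + k3*y4 - k4*y3)\<^sup>2 +
      (k1*y3 - k2*y4 - k3*y1 + k4*y2)\<^sup>2 + (k1*y4 + k2*y3 - k3*y2 - k4*y1)\<^sup>2)"
    by (simp add: power2_eq_square algebra_simps)
  finally have "r * p = (r + q)\<^sup>2 + (k1*y2 - k2*y1 + k3*y4 - k4*y3)\<^sup>2 +
      (k1*y3 - k2*y4 - k3*y1 + k4*y2)\<^sup>2 + (k1*y4 + k2*y3 - k3*y2 - k4*y1)\<^sup>2"
    using m by simp
  then have "sum4sq (r * p)" unfolding sum4sq_def by blast
  then show ?thesis using \<open>r \<ge> 0\<close> \<open>r \<noteq> 0\<close> \<open>r \<le> m\<close> \<open>r \<noteq> m\<close> by (intro exI[of _ r]) auto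
qed

text \<open>For odd \<open>p\<close> the pigeonhole lemma provides a multiple \<open>m * p\<close>
  with \<open>1 \<le> m\<close> and \<open>m < p\<close> that is a sum of four squares. Descent then
  lowers the multiplier until it is 1.\<close>

lemma sum4sq_prime:
  fixes p :: int
  assumes "prime p"
  shows "sum4sq p"
proof (cases "odd p")
  case False
  then have "p = 2" using assms primes_dvd_imp_eq two_is_prime_nat
    by (metis prime_int_numeral_eq two_is_prime_nat)
  then have "p = 1\<^sup>2 + 1\<^sup>2 + 0\<^sup>2 + 0\<^sup>2" by simp
  then show ?thesis unfolding sum4sq_def by blast
next
  case True
  obtain a b where ab: "p dvd a\<^sup>2 + b\<^sup>2 + 1" "0 \<le> a" "2 * a < p" "0 \<le> b" "2 * b < p"
    using exists_sum2sq_plus_one_dvd[OF assms True] .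
  then obtain m where m: "a\<^sup>2 + b\<^sup>2 + 1 = m * p" by (metis dvd_def mult.commute)
  have p: "p > 2" using assms True prime_ge_2_int[of p] by (cases "p = 2") auto
  have "m * p > 0" unfolding m[symmetric] by (smt (verit) zero_le_power2)
  then have "m \<ge> 1" using p by (simp add: zero_less_mult_iff)
  have "4 * a\<^sup>2 < p\<^sup>2" "4 * b\<^sup>2 < p\<^sup>2"
    using power_strict_mono[OF ab(3), of 2] power_strict_mono[OF ab(5), of 2] ab
    by (simp_all add: power_mult_distrib)
  moreover have "4 < p\<^sup>2" using power_strict_mono[OF p, of 2] by simp
  \<comment> \<open>Each of the three summands of a^2 + b^2 + 1 is below p^2/4.\<close>
  ultimately have "m * p < p * p" using m unfolding power2_eq_square by linarith
  then have "m < p" using p by simp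
  have "m * p = a\<^sup>2 + b\<^sup>2 + 1\<^sup>2 + 0\<^sup>2" using m by simp
  then have "sum4sq (m * p)" unfolding sum4sq_def by blast
  then show ?thesis using \<open>m \<ge> 1\<close> \<open>m < p\<close>
  proof (induction "nat m" arbitrary: m rule: less_induct)
    case less
    show ?case
    proof (cases "m = 1")
      case True
      then show ?thesis using less by simp
    next
      case False
      then obtain r where "1 \<le> r" "r < m" "sum4sq (r * p)"
        using sum4sq_descent[OF assms, of m] less by auto
      then show ?thesis using less by auto
    qed
  qed
qed

theorem four_squares:
  fixes n :: nat
  shows "sum4sq (int n)"
proof (induction n rule: prime_divisors_induct)
  case zero
  have "int 0 = 0\<^sup>2 + 0\<^sup>2 + 0\<^sup>2 + 0\<^sup>2" by simp
  then show ?case unfolding sum4sq_def by blast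
next
  case (unit n)
  then have "int n = 1\<^sup>2 + 0\<^sup>2 + 0\<^sup>2 + 0\<^sup>2" by simp
  then show ?case unfolding sum4sq_def by blast
next
  case (factor p n)
  then show ?case using sum4sq_mult[OF sum4sq_prime[of "int p"]] by simp
qed

section \<open>Arithmetic expressions and the systems computing them\<close>

datatype expr = Var nat | Unit | Plus expr expr | Minus expr expr | Times expr expr

fun val :: "(nat \<Rightarrow> int) \<Rightarrow> expr \<Rightarrow> int" where
  "val x (Var i) = x i"
| "val x Unit = 1"
| "val x (Plus a b) = val x a + val x b"
| "val x (Minus a b) = val x a - val x b"
| "val x (Times a b) = val x a * val x b"

fun evars :: "expr \<Rightarrow> nat set" where
  "evars (Var i) = {i}"
| "evars Unit = {}"
| "evars (Plus a b) = evars a \<union> evars b"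
| "evars (Minus a b) = evars a \<union> evars b"
| "evars (Times a b) = evars a \<union> evars b"

text \<open>This measure bounds the number of fresh variables spent on computing an
  expression.\<close>

fun nodes :: "expr \<Rightarrow> nat" where
  "nodes (Var i) = 1"
| "nodes Unit = 1"
| "nodes (Plus a b) = nodes a + nodes b + 1"
| "nodes (Minus a b) = nodes a + nodes b + 1"
| "nodes (Times a b) = nodes a + nodes b + 1"

fun subst :: "(nat \<Rightarrow> expr) \<Rightarrow> expr \<Rightarrow> expr" where
  "subst s (Var i) = s i"
| "subst s Unit = Unit"
| "subst s (Plus a b) = Plus (subst s a) (subst s b)"
| "subst s (Minus a b) = Minus (subst s a) (subst s b)"
| "subst s (Times a b) = Times (subst s a) (subst s b)"

lemma val_cong: "(\<And>i. i \<in> evars e \<Longrightarrow> x i = y i) \<Longrightarrow> val x e = val y e"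
  by (induction e) auto

lemma val_subst: "val x (subst s e) = val (\<lambda>i. val x (s i)) e"
  by (induction e) auto

lemma evars_subst: "evars (subst s e) = (\<Union>i\<in>evars e. evars (s i))"
  by (induction e) auto

text \<open>Each leaf grows by a factor of at most \<open>M\<close>. For a fixed \<open>e\<close>
  the bound is linear in \<open>M\<close>, which yields a size linear in \<open>t\<close>
  later.\<close>

lemma nodes_subst:
  assumes "\<And>i. i \<in> evars e \<Longrightarrow> nodes (s i) \<le> M" "M \<ge> 1"
  shows "nodes (subst s e) \<le> M * nodes e"
  using assms
proof (induction e)
  case (Plus a b)
  then have "nodes (subst s a) \<le> M * nodes a" "nodes (subst s b) \<le> M * nodes b" by auto
  then show ?case using Plus.prems(2) by (simp add: algebra_simps)
next
  case (Minus a b)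
  then have "nodes (subst s a) \<le> M * nodes a" "nodes (subst s b) \<le> M * nodes b" by auto
  then show ?case using Minus.prems(2) by (simp add: algebra_simps)
next
  case (Times a b)
  then have "nodes (subst s a) \<le> M * nodes a" "nodes (subst s b) \<le> M * nodes b" by auto
  then show ?case using Times.prems(2) by (simp add: algebra_simps)
qed auto

section \<open>Polynomials written as arithmetic expressions\<close>

definition expressible :: "nat set \<Rightarrow> ((nat \<Rightarrow> int) \<Rightarrow> int) \<Rightarrow> bool" where
  "expressible X f \<longleftrightarrow> (\<exists>e. evars e \<subseteq> X \<and> (\<forall>v. val v e = f v))"

lemma expressible_var: "i \<in> X \<Longrightarrow> expressible X (\<lambda>v. v i)"
  unfolding expressible_def by (rule exI[of _ "Var i"]) simp

lemma expressible_one: "expressible X (\<lambda>_. 1)"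
  unfolding expressible_def by (rule exI[of _ Unit]) simp

lemma expressible_add:
  assumes "expressible X f" "expressible X h"
  shows "expressible X (\<lambda>v. f v + h v)"
proof -
  obtain a b where "evars a \<subseteq> X" "\<forall>v. val v a = f v" "evars b \<subseteq> X" "\<forall>v. val v b = h v"
    using assms unfolding expressible_def by blast
  then show ?thesis unfolding expressible_def by (intro exI[of _ "Plus a b"]) simp
qed

lemma expressible_diff:
  assumes "expressible X f" "expressible X h"
  shows "expressible X (\<lambda>v. f v - h v)"
proof -
  obtain a b where "evars a \<subseteq> X" "\<forall>v. val v a = f v" "evars b \<subseteq> X" "\<forall>v. val v b = h v"
    using assms unfolding expressible_def by blast
  then show ?thesis unfolding expressible_def by (intro exI[of _ "Minus a b"]) simp
qed

lemma expressible_mult: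
  assumes "expressible X f" "expressible X h"
  shows "expressible X (\<lambda>v. f v * h v)"
proof -
  obtain a b where "evars a \<subseteq> X" "\<forall>v. val v a = f v" "evars b \<subseteq> X" "\<forall>v. val v b = h v"
    using assms unfolding expressible_def by blast
  then show ?thesis unfolding expressible_def by (intro exI[of _ "Times a b"]) simp
qed

lemma expressible_const: "expressible X (\<lambda>_. c)"
proof (induction c rule: int_induct[of _ 0])
  case base
  show ?case using expressible_diff[OF expressible_one expressible_one] by simp
qed (auto intro: expressible_add expressible_diff expressible_one)

lemma expressible_power: "expressible X f \<Longrightarrow> expressible X (\<lambda>v. f v ^ n)"
  by (induction n) (auto intro: expressible_one expressible_mult)

lemma expressible_sum:
  "(\<And>t. t \<in> T \<Longrightarrow> expressible X (f t)) \<Longrightarrow> expressible X (\<lambda>v. \<Sum>t\<in>T. f t v)"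
  by (induction T rule: infinite_finite_induct) (auto intro: expressible_const expressible_add)

lemma expressible_prod:
  "(\<And>t. t \<in> T \<Longrightarrow> expressible X (f t)) \<Longrightarrow> expressible X (\<lambda>v. \<Prod>t\<in>T. f t v)"
  by (induction T rule: infinite_finite_induct) (auto intro: expressible_one expressible_mult)

text \<open>No size bound is recorded: the polynomial is fixed, so the size of its expression is a
  constant while \<open>t\<close> grows.\<close>

lemma expressible_eval_mpoly: "expressible (vars W) (eval_mpoly W)"
  unfolding eval_mpoly_def
  by (intro expressible_sum expressible_mult expressible_const expressible_prod
        expressible_power expressible_var) (auto simp: vars_def)

section \<open>Extending systems without changing the number of solutions\<close>

lemma satisfies_cong:
  assumes "e \<in> E n" "\<And>i. i \<in> {1..n} \<Longrightarrow> x i = y i"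
  shows "satisfies x e = satisfies y e"
  using assms unfolding E_def by auto

lemma E_mono: "n \<le> N \<Longrightarrow> E n \<subseteq> E N"
  unfolding E_def by fastforce

text \<open>The new equation determines the fresh coordinate from the old ones, so every old
  solution extends in exactly one way.\<close>

lemma bij_betw_solutions_Suc:
  assumes S: "S \<subseteq> E n"
    and e: "\<And>x. satisfies x e \<longleftrightarrow> x (Suc n) = h (restrict x {1..n})"
  shows "bij_betw (\<lambda>x. restrict x {1..n}) (solutions (Suc n) (insert e S)) (solutions n S)"
proof (rule bij_betw_byWitness[where f' = "\<lambda>y. y(Suc n := h y)"])
  have S_cong: "(\<forall>e\<in>S. satisfies x e) \<longleftrightarrow> (\<forall>e\<in>S. satisfies y e)"
    if "\<And>i. i \<in> {1..n} \<Longrightarrow> x i = y i" for x y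
  proof (rule ball_cong[OF refl])
    fix e assume "e \<in> S"
    then have "e \<in> E n" using S by blast
    then show "satisfies x e = satisfies y e" using that by (rule satisfies_cong)
  qed
  have ext: "restrict (y(Suc n := h y)) {1..n} = y" if "y \<in> solutions n S" for y
    using that unfolding solutions_def by (auto simp: fun_eq_iff PiE_def extensional_def)
  show "\<forall>x\<in>solutions (Suc n) (insert e S).
      (restrict x {1..n})(Suc n := h (restrict x {1..n})) = x"
  proof
    fix x assume x: "x \<in> solutions (Suc n) (insert e S)"
    then have "h (restrict x {1..n}) = x (Suc n)" using e unfolding solutions_def by simp
    moreover have "(restrict x {1..n})(Suc n := x (Suc n)) = x"
      using x unfolding solutions_def by (auto simp: fun_eq_iff PiE_def extensional_def)
    ultimately show "(restrict x {1..n})(Suc n := h (restrict x {1..n})) = x" by simp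
  qed
  show "\<forall>y\<in>solutions n S. restrict (y(Suc n := h y)) {1..n} = y"
    using ext by blast
  show "(\<lambda>x. restrict x {1..n}) ` solutions (Suc n) (insert e S) \<subseteq> solutions n S"
  proof (rule image_subsetI)
    fix x assume "x \<in> solutions (Suc n) (insert e S)"
    then have "\<forall>e\<in>S. satisfies (restrict x {1..n}) e"
      using S_cong[of "restrict x {1..n}" x] unfolding solutions_def by auto
    then show "restrict x {1..n} \<in> solutions n S" unfolding solutions_def by auto
  qed
  show "(\<lambda>y. y(Suc n := h y)) ` solutions n S \<subseteq> solutions (Suc n) (insert e S)"
  proof (rule image_subsetI)
    fix y assume y: "y \<in> solutions n S"
    have "\<forall>e\<in>S. satisfies (y(Suc n := h y)) e"
      using S_cong[of y "y(Suc n := h y)"] y unfolding solutions_def by auto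
    moreover have "satisfies (y(Suc n := h y)) e"
      using e ext[OF y] by auto
    moreover have "y(Suc n := h y) \<in> {1..Suc n} \<rightarrow>\<^sub>E UNIV"
      using y unfolding solutions_def by (auto simp: PiE_def extensional_def)
    ultimately show "y(Suc n := h y) \<in> solutions (Suc n) (insert e S)"
      unfolding solutions_def by blast
  qed
qed

text \<open>The bijection by restriction, rather than mere solvability, is demanded because
  solutions must be counted exactly.\<close>

definition computes ::
    "nat \<Rightarrow> equation set \<Rightarrow> nat \<Rightarrow> equation set \<Rightarrow> nat \<Rightarrow> expr \<Rightarrow> bool" where
  "computes n S N S' k e \<longleftrightarrow> n \<le> N \<and> S' \<subseteq> E N \<and> k \<in> {1..N} \<and>
     bij_betw (\<lambda>x. restrict x {1..n}) (solutions N S') (solutions n S) \<and>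
     (\<forall>x\<in>solutions N S'. x k = val x e)"

text \<open>The common inductive step for the three binary operations: the system for
  \<open>b\<close> is stacked on the one for \<open>a\<close>, and \<open>q\<close> defines one more
  variable as the result of the operation \<open>f\<close>.\<close>

lemma computes_step:
  assumes "computes n S N1 S1 k1 a" "computes N1 S1 N2 S2 k2 b" "evars a \<subseteq> {1..n}"
    and q: "q \<in> E (Suc N2)"
    and sat: "\<And>x. satisfies x q \<longleftrightarrow> x (Suc N2) = f (x k1) (x k2)"
    and e: "\<And>x. val x e = f (val x a) (val x b)" "evars e = evars a \<union> evars b"
    and vb: "evars b \<subseteq> {1..n}"
  shows "computes n S (Suc N2) (insert q S2) (Suc N2) e"
proof -
  note A = assms(1)[unfolded computes_def] and B = assms(2)[unfolded computes_def]
  have k: "k1 \<in> {1..N1}" "k2 \<in> {1..N2}" "n \<le> N1" "N1 \<le> N2" using A B by auto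
  have bij: "bij_betw (\<lambda>x. restrict x {1..N2}) (solutions (Suc N2) (insert q S2)) (solutions N2 S2)"
  proof (rule bij_betw_solutions_Suc[where h = "\<lambda>x. f (x k1) (x k2)"])
    show "S2 \<subseteq> E N2" using B by blast
    show "\<And>x. satisfies x q = (x (Suc N2) = f (restrict x {1..N2} k1) (restrict x {1..N2} k2))"
      using sat k by auto
  qed
  have "bij_betw (\<lambda>x. restrict x {1..N1}) (solutions N2 S2) (solutions N1 S1)"
    "bij_betw (\<lambda>x. restrict x {1..n}) (solutions N1 S1) (solutions n S)"
    using A B by blast+
  note bij_betw_trans[OF bij_betw_trans[OF bij this(1)] this(2)]
  moreover have "(\<lambda>x. restrict x {1..n}) \<circ> ((\<lambda>x. restrict x {1..N1}) \<circ> (\<lambda>x. restrict x {1..N2}))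
      = (\<lambda>x :: nat \<Rightarrow> int. restrict x {1..n})"
    using k by (auto simp: fun_eq_iff)
  ultimately have bij': "bij_betw (\<lambda>x. restrict x {1..n})
      (solutions (Suc N2) (insert q S2)) (solutions n S)" by simp
  have "x (Suc N2) = val x e" if x: "x \<in> solutions (Suc N2) (insert q S2)" for x
  proof -
    let ?x2 = "restrict x {1..N2}" and ?x1 = "restrict (restrict x {1..N2}) {1..N1}"
    have x2: "?x2 \<in> solutions N2 S2" using bij x by (rule bij_betw_apply)
    moreover have "bij_betw (\<lambda>x. restrict x {1..N1}) (solutions N2 S2) (solutions N1 S1)"
      using B by blast
    ultimately have x1: "?x1 \<in> solutions N1 S1" using bij_betw_apply by fastforce
    have "x k1 = ?x1 k1" "x k2 = ?x2 k2" using k by auto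
    moreover have "?x1 k1 = val ?x1 a" using A x1 by blast
    moreover have "?x2 k2 = val ?x2 b" using B x2 by blast
    moreover have "val ?x1 a = val x a" "val ?x2 b = val x b"
      using k assms(3) vb by (auto intro!: val_cong)
    moreover have "x (Suc N2) = f (x k1) (x k2)"
      using x sat unfolding solutions_def by blast
    ultimately show ?thesis using e by simp
  qed
  moreover have "insert q S2 \<subseteq> E (Suc N2)"
    using q B E_mono[of N2 "Suc N2"] by auto
  ultimately show ?thesis using bij' k unfolding computes_def by auto
qed

lemma exists_computes:
  assumes "S \<subseteq> E n" "evars e \<subseteq> {1..n}"
  shows "\<exists>N S' k. N \<le> n + nodes e \<and> computes n S N S' k e"
  using assms
proof (induction e arbitrary: n S)
  case (Var i)
  have "restrict x {1..n} = x" if "x \<in> solutions n S" for x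
    using that by (auto simp: solutions_def PiE_def extensional_restrict)
  then have "bij_betw (\<lambda>x. restrict x {1..n}) (solutions n S) (solutions n S)"
    by (simp add: bij_betw_def inj_on_def)
  then have "computes n S n S i (Var i)" using Var unfolding computes_def by auto
  then show ?case by (metis le_add1)
next
  case Unit
  have "bij_betw (\<lambda>x. restrict x {1..n}) (solutions (Suc n) (insert (One (Suc n)) S)) (solutions n S)"
    by (rule bij_betw_solutions_Suc[where h = "\<lambda>_. 1"]) (use Unit in auto)
  moreover have "insert (One (Suc n)) S \<subseteq> E (Suc n)"
  proof -
    have "One (Suc n) \<in> E (Suc n)" by (simp add: E_def)
    then show ?thesis using Unit E_mono[of n "Suc n"] by auto
  qed
  moreover have "x (Suc n) = 1" if "x \<in> solutions (Suc n) (insert (One (Suc n)) S)" for x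
    using that unfolding solutions_def by simp
  ultimately have "computes n S (Suc n) (insert (One (Suc n)) S) (Suc n) Unit"
    unfolding computes_def by auto
  then show ?case by (metis Suc_eq_plus1 le_refl nodes.simps(2))
next
  case (Plus a b)
  have "evars a \<subseteq> {1..n}" using Plus.prems by simp
  from Plus.IH(1)[OF Plus.prems(1) this]
  obtain N1 S1 k1 where 1: "N1 \<le> n + nodes a" "computes n S N1 S1 k1 a" by blast
  then have "S1 \<subseteq> E N1" "evars b \<subseteq> {1..N1}"
    using Plus.prems unfolding computes_def by auto
  from Plus.IH(2)[OF this]
  obtain N2 S2 k2 where 2: "N2 \<le> N1 + nodes b" "computes N1 S1 N2 S2 k2 b" by blast
  have "computes n S (Suc N2) (insert (Add k1 k2 (Suc N2)) S2) (Suc N2) (Plus a b)"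
  proof (rule computes_step[OF 1(2) 2(2), where f = "(+)"])
    have "k1 \<in> {1..Suc N2}" "k2 \<in> {1..Suc N2}"
      using 1(2) 2(2) by (auto simp: computes_def)
    then show "Add k1 k2 (Suc N2) \<in> E (Suc N2)" by (simp add: E_def)
  qed (use Plus.prems in auto)
  moreover have "Suc N2 \<le> n + nodes (Plus a b)" using 1 2 by simp
  ultimately show ?case by blast
next
  case (Minus a b)
  have "evars a \<subseteq> {1..n}" using Minus.prems by simp
  from Minus.IH(1)[OF Minus.prems(1) this]
  obtain N1 S1 k1 where 1: "N1 \<le> n + nodes a" "computes n S N1 S1 k1 a" by blast
  then have "S1 \<subseteq> E N1" "evars b \<subseteq> {1..N1}"
    using Minus.prems unfolding computes_def by auto
  from Minus.IH(2)[OF this]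
  obtain N2 S2 k2 where 2: "N2 \<le> N1 + nodes b" "computes N1 S1 N2 S2 k2 b" by blast
  \<comment> \<open>A difference is defined through addition: the new variable plus the subtrahend
    equals the minuend.\<close>
  have "computes n S (Suc N2) (insert (Add (Suc N2) k2 k1) S2) (Suc N2) (Minus a b)"
  proof (rule computes_step[OF 1(2) 2(2), where f = "(-)"])
    have "k1 \<in> {1..Suc N2}" "k2 \<in> {1..Suc N2}"
      using 1(2) 2(2) by (auto simp: computes_def)
    then show "Add (Suc N2) k2 k1 \<in> E (Suc N2)" by (simp add: E_def)
  qed (use Minus.prems in auto)
  moreover have "Suc N2 \<le> n + nodes (Minus a b)" using 1 2 by simp
  ultimately show ?case by blast
next
  case (Times a b)
  have "evars a \<subseteq> {1..n}" using Times.prems by simp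
  from Times.IH(1)[OF Times.prems(1) this]
  obtain N1 S1 k1 where 1: "N1 \<le> n + nodes a" "computes n S N1 S1 k1 a" by blast
  then have "S1 \<subseteq> E N1" "evars b \<subseteq> {1..N1}"
    using Times.prems unfolding computes_def by auto
  from Times.IH(2)[OF this]
  obtain N2 S2 k2 where 2: "N2 \<le> N1 + nodes b" "computes N1 S1 N2 S2 k2 b" by blast
  have "computes n S (Suc N2) (insert (Mult k1 k2 (Suc N2)) S2) (Suc N2) (Times a b)"
  proof (rule computes_step[OF 1(2) 2(2), where f = "(*)"])
    have "k1 \<in> {1..Suc N2}" "k2 \<in> {1..Suc N2}"
      using 1(2) 2(2) by (auto simp: computes_def)
    then show "Mult k1 k2 (Suc N2) \<in> E (Suc N2)" by (simp add: E_def)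
  qed (use Times.prems in auto)
  moreover have "Suc N2 \<le> n + nodes (Times a b)" using 1 2 by simp
  ultimately show ?case by blast
qed

text \<open>Starting from the empty system, whose solutions are all \<open>n\<close>-tuples, one
  computes \<open>e\<close> and then forces its value to be 0. The resulting subsystem of
  \<open>E N\<close> has as many solutions as \<open>e\<close> has roots.\<close>

lemma card_roots_le_max_finite_solutions:
  assumes "evars e \<subseteq> {1..n}"
    and fin: "finite {y \<in> {1..n} \<rightarrow>\<^sub>E (UNIV :: int set). val y e = 0}"
  obtains N where "1 \<le> N" "N \<le> n + nodes e"
    "card {y \<in> {1..n} \<rightarrow>\<^sub>E (UNIV :: int set). val y e = 0} \<le> max_finite_solutions N"
proof -
  let ?Z = "{y \<in> {1..n} \<rightarrow>\<^sub>E (UNIV :: int set). val y e = 0}"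
  obtain N S k where N: "N \<le> n + nodes e" "computes n {} N S k e"
    using exists_computes[of "{}" n e] assms by auto
  note C = N(2)[unfolded computes_def]
  let ?r = "\<lambda>x :: nat \<Rightarrow> int. restrict x {1..n}"
  \<comment> \<open>The equation x_k + x_k = x_k says that x_k = 0.\<close>
  let ?S = "insert (Add k k k) S"
  have sol: "solutions N ?S = {x \<in> solutions N S. val (?r x) e = 0}"
  proof -
    have "val (?r x) e = x k" if "x \<in> solutions N S" for x
    proof -
      have "val (?r x) e = val x e" using assms(1) by (intro val_cong) auto
      then show ?thesis using C that by simp
    qed
    then show ?thesis unfolding solutions_def by auto
  qed
  have bij: "bij_betw ?r (solutions N S) (solutions n {})" using C by blast
  then have inj: "inj_on ?r (solutions N ?S)"
    unfolding sol by (auto simp: bij_betw_def inj_on_def)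
  have img: "?r ` solutions N ?S = ?Z"
  proof -
    have "?r ` solutions N ?S = {y \<in> ?r ` solutions N S. val y e = 0}"
      unfolding sol by auto
    also have "?r ` solutions N S = solutions n {}" using bij by (simp add: bij_betw_def)
    also have "solutions n {} = {1..n} \<rightarrow>\<^sub>E UNIV" by (simp add: solutions_def)
    finally show ?thesis .
  qed
  have "Add k k k \<in> E N" using C by (simp add: E_def)
  then have "?S \<subseteq> E N" using C by blast
  moreover have "finite (solutions N ?S)" using img fin inj finite_imageD by metis
  ultimately have "card (solutions N ?S) \<in> finite_solution_counts N"
    unfolding finite_solution_counts_def by blast
  then have "card (solutions N ?S) \<le> max_finite_solutions N"
    unfolding max_finite_solutions_def using finite_finite_solution_counts by simp
  moreover have "card (solutions N ?S) = card ?Z" using img inj card_image by metis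
  moreover have "1 \<le> N" using C by auto
  ultimately show thesis using that N(1) by simp
qed

section \<open>The equation with many solutions\<close>

text \<open>The blocks partition the positive indices, matching the numbering of variables from 1 in
  \<open>E\<close>.\<close>

definition block_norm :: "(nat \<Rightarrow> int) \<Rightarrow> nat \<Rightarrow> int" where
  "block_norm y j = (y (4*j+1))\<^sup>2 + (y (4*j+2))\<^sup>2 + (y (4*j+3))\<^sup>2 + (y (4*j+4))\<^sup>2"

definition square :: "nat \<Rightarrow> expr" where
  "square i = Times (Var i) (Var i)"

definition block_expr :: "nat \<Rightarrow> expr" where
  "block_expr j = Plus (Plus (square (4*j+1)) (square (4*j+2))) (Plus (square (4*j+3)) (square (4*j+4)))"

text \<open>Repeated doubling reaches an exponentially large constant with linearly many
  nodes.\<close>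

fun pow2_expr :: "nat \<Rightarrow> expr" where
  "pow2_expr 0 = Unit"
| "pow2_expr (Suc t) = Times (Plus Unit Unit) (pow2_expr t)"

lemma val_block_expr: "val y (block_expr j) = block_norm y j"
  by (simp add: block_expr_def square_def block_norm_def power2_eq_square)

lemma evars_block_expr: "evars (block_expr j) = {4*j+1, 4*j+2, 4*j+3, 4*j+4}"
  by (auto simp: block_expr_def square_def)

lemma nodes_block_expr: "nodes (block_expr j) = 15"
  by (simp add: block_expr_def square_def)

lemma val_pow2_expr: "val y (pow2_expr t) = 2 ^ t"
  by (induction t) auto

lemma evars_pow2_expr: "evars (pow2_expr t) = {}"
  by (induction t) auto

lemma nodes_pow2_expr: "nodes (pow2_expr t) = 4 * t + 1"
  by (induction t) auto

lemma block_norm_nonneg: "block_norm y j \<ge> 0"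
  by (simp add: block_norm_def)

text \<open>An integer is bounded in absolute value by its square. Hence bounded block norms leave
  only finitely many tuples.\<close>

lemma abs_le_block_norm:
  assumes "1 \<le> i"
  shows "\<bar>y i\<bar> \<le> block_norm y ((i - 1) div 4)"
proof -
  have sq: "\<bar>z\<bar> \<le> z\<^sup>2" for z :: int
    using self_le_power[of "\<bar>z\<bar>" 2] by (cases "z = 0") auto
  define j where "j = (i - 1) div 4"
  define r where "r = (i - 1) mod 4"
  have "i = 4 * j + r + 1" "r < 4" using assms by (simp_all add: j_def r_def)
  then have "i \<in> {4*j+1, 4*j+2, 4*j+3, 4*j+4}" by auto
  then have "(y i)\<^sup>2 \<le> block_norm y j" unfolding block_norm_def by auto
  then show ?thesis using sq[of "y i"] unfolding j_def by linarith
qed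

text \<open>Lagrange's theorem is applied to each block separately; index \<open>i\<close> is
  position \<open>(i - 1) mod 4\<close> of block \<open>(i - 1) div 4\<close>.\<close>

lemma exists_block_norms:
  fixes v :: "nat \<Rightarrow> nat"
  obtains y where "\<And>j. j < k \<Longrightarrow> block_norm y j = int (v j)" "y \<in> {1..4*k} \<rightarrow>\<^sub>E UNIV"
proof -
  have "\<exists>q :: nat \<Rightarrow> int. int u = (q 0)\<^sup>2 + (q 1)\<^sup>2 + (q 2)\<^sup>2 + (q 3)\<^sup>2" for u :: nat
  proof -
    obtain a b c d where "int u = a\<^sup>2 + b\<^sup>2 + c\<^sup>2 + d\<^sup>2"
      using four_squares[of u] unfolding sum4sq_def by blast
    then show ?thesis by (intro exI[of _ "(!) [a, b, c, d]"]) (simp add: eval_nat_numeral)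
  qed
  then obtain q :: "nat \<Rightarrow> nat \<Rightarrow> int"
    where q: "\<And>u. int u = (q u 0)\<^sup>2 + (q u 1)\<^sup>2 + (q u 2)\<^sup>2 + (q u 3)\<^sup>2" by metis
  define y where "y = restrict (\<lambda>i. q (v ((i - 1) div 4)) ((i - 1) mod 4)) {1..4*k}"
  have "block_norm y j = int (v j)" if "j < k" for j
  proof -
    have "(4*j + 1) div 4 = j" "(4*j + 2) div 4 = j" "(4*j + 3) div 4 = j"
      "(4*j + 1) mod 4 = 1" "(4*j + 2) mod 4 = 2" "(4*j + 3) mod 4 = 3"
      by presburger+
    then have "y (4*j+1) = q (v j) 0" "y (4*j+2) = q (v j) 1" "y (4*j+3) = q (v j) 2"
        "y (4*j+4) = q (v j) 3"
      using that unfolding y_def by simp_all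
    then show ?thesis using q[of "v j"] unfolding block_norm_def by simp
  qed
  moreover have "y \<in> {1..4*k} \<rightarrow>\<^sub>E UNIV" unfolding y_def by simp
  ultimately show thesis using that by blast
qed

lemma eval_mpoly_cong:
  "(\<And>i. i \<in> vars W \<Longrightarrow> u i = v i) \<Longrightarrow> eval_mpoly W u = eval_mpoly W v"
  unfolding eval_mpoly_def vars_def
  by (intro sum.cong prod.cong arg_cong2[where f = "(*)"] refl arg_cong2[where f = "(^)"]) auto

lemma exists_linear_le_power2: "\<exists>t. A + B * t \<le> (2::nat) ^ t"
proof -
  \<comment> \<open>The exponent will be \<open>2 * s\<close>. This \<open>s\<close> makes s^2 at
    least 2 B s and 2 s at least \<open>A\<close>, so (s+1)^2 dominates the linear term.\<close>
  define s where "s = A + 2 * B"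
  have "A + B * (2 * s) \<le> (s + 1) * (s + 1)"
    unfolding s_def by (simp add: algebra_simps)
  also have "\<dots> \<le> 2 ^ s * 2 ^ s"
    using less_exp[of s] by (intro mult_le_mono) linarith+
  also have "\<dots> = 2 ^ (2 * s)" by (simp add: power_add mult_2)
  finally show ?thesis by blast
qed

text \<open>
  The substitution $a := 2^t$, $b := u + v$, with $u$, $v$ and every unknown replaced by a sum of
  four squares; splitting $b$ produces at least $b + 1$ solutions.
\<close>

definition arguments :: "nat \<Rightarrow> nat \<Rightarrow> expr" where
  "arguments t i = (if i = 0 then pow2_expr t
     else if i = 1 then Plus (block_expr 0) (block_expr 1) else block_expr i)"

theorem theorem1:
  fixes g :: "nat \<Rightarrow> nat"
  assumes "\<And>n. n \<ge> 1 \<Longrightarrow> g n \<ge> 1"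
    and "mono_on {1..} g"
    and "\<And>n. n \<ge> 1 \<Longrightarrow> max_finite_solutions n \<le> g n"
  shows "\<not> (\<exists>m W. finite_fold_representation 2 (graph_pos g) m W)"
proof
  assume "\<exists>m W. finite_fold_representation 2 (graph_pos g) m W"
  then obtain m W where "finite_fold_representation 2 (graph_pos g) m W" by blast
  then have vars: "vars W \<subseteq> {..<2 + m}"
    and rep: "\<And>a b. [a, b] \<in> graph_pos g \<longleftrightarrow> zeros m W [a, b] \<noteq> {}"
    and fin: "\<And>a b. finite (zeros m W [a, b])"
    unfolding finite_fold_representation_def diophantine_representation_def by auto
  obtain w where w: "evars w \<subseteq> {..<2 + m}" "\<And>v. val v w = eval_mpoly W v"
    using expressible_eval_mpoly[of W] vars unfolding expressible_def by blast
  let ?n = "4 * (m + 2)"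
  \<comment> \<open>Every substituted argument has at most 4t + 31 nodes: 4t + 1 for the power of
    two, 15 + 15 + 1 for the sum of two blocks, 15 for one block.\<close>
  obtain t where t: "?n + 31 * nodes w + (4 * nodes w) * t \<le> 2 ^ t"
    using exists_linear_le_power2 by blast
  let ?a = "2 ^ t :: nat"
  have a: "?a \<ge> 1" by simp
  define e where "e = subst (arguments t) w"
  have "evars (arguments t i) \<subseteq> {1..?n}" if "i < 2 + m" for i
    using that by (auto simp: arguments_def evars_pow2_expr evars_block_expr)
  then have evars_e: "evars e \<subseteq> {1..?n}" using w(1) unfolding e_def evars_subst by blast
  have "nodes e \<le> (4 * t + 31) * nodes w"
    unfolding e_def
    by (rule nodes_subst) (auto simp: arguments_def nodes_pow2_expr nodes_block_expr)
  then have size: "?n + nodes e \<le> ?a" using t by (simp add: algebra_simps)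
  define x where "x y = map (\<lambda>i. nat (block_norm y (i + 2))) [0..<m]" for y
  define b where "b y = nat (block_norm y 0 + block_norm y 1)" for y
  have val_e: "val y e = 0 \<longleftrightarrow> x y \<in> zeros m W [?a, b y]" for y
  proof -
    have "val y e = eval_mpoly W (\<lambda>i. val y (arguments t i))"
      unfolding e_def val_subst w(2) ..
    also have "\<dots> = eval_mpoly W (\<lambda>i. int (([?a, b y] @ x y) ! i))"
    proof (rule eval_mpoly_cong)
      fix i assume "i \<in> vars W"
      then have "i < 2 + m" using vars by blast
      then consider "i = 0" | "i = 1" | j where "i = j + 2" "j < m"
        by (metis One_nat_def add.commute less_2_cases linorder_not_less nat_add_left_cancel_less
            le_Suc_ex)
      then show "val y (arguments t i) = int (([?a, b y] @ x y) ! i)"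
        by cases (simp_all add: arguments_def val_pow2_expr val_block_expr b_def x_def
            block_norm_nonneg)
    qed
    finally show ?thesis by (simp add: zeros_def x_def)
  qed
  let ?Z = "{y \<in> {1..?n} \<rightarrow>\<^sub>E (UNIV :: int set). val y e = 0}"
  have finite_Z: "finite ?Z"
  proof -
    \<comment> \<open>Being in the graph forces \<open>b y = g ?a\<close>, so only one set of zeros
      matters. It is finite, and summing all entries of all its members bounds each of them.\<close>
    define B where "B = int (g ?a) + (\<Sum>x\<in>zeros m W [?a, g ?a]. int (sum_list x))"
    have "?Z \<subseteq> {1..?n} \<rightarrow>\<^sub>E {-B..B}"
    proof
      fix y assume y: "y \<in> ?Z"
      then have xy: "x y \<in> zeros m W [?a, b y]" using val_e by blast
      then have "[?a, b y] \<in> graph_pos g" using rep by blast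
      then have b: "b y = g ?a" by (auto simp: graph_pos_def)
      have "int (sum_list (x y)) \<le> (\<Sum>x\<in>zeros m W [?a, g ?a]. int (sum_list x))"
        using xy fin unfolding b by (intro member_le_sum) auto
      moreover have "(\<Sum>x\<in>zeros m W [?a, g ?a]. int (sum_list x)) \<ge> 0"
        by (intro sum_nonneg) simp
      ultimately have sums: "int (sum_list (x y)) \<le> B" "int (g ?a) \<le> B"
        unfolding B_def by simp_all
      have norm: "block_norm y j \<le> B" if "j < m + 2" for j
      proof (cases "j < 2")
        case True
        have "block_norm y 0 + block_norm y 1 = int (g ?a)"
          using b[symmetric] block_norm_nonneg[of y] unfolding b_def by simp
        moreover have "j = 0 \<or> j = 1" using True by auto
        ultimately show ?thesis
          using sums(2) block_norm_nonneg[of y 0] block_norm_nonneg[of y 1] by auto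
      next
        case False
        then have "nat (block_norm y j) \<in> set (x y)"
          using that le_add_diff_inverse2[of 2 j] unfolding x_def
          by (auto intro!: image_eqI[of _ _ "j - 2"])
        then have "nat (block_norm y j) \<le> sum_list (x y)" by (rule member_le_sum_list) simp
        then show ?thesis using sums(1) by linarith
      qed
      have "y i \<in> {-B..B}" if "i \<in> {1..?n}" for i
      proof -
        have "1 \<le> i" "(i - 1) div 4 < m + 2" using that by auto
        then have "\<bar>y i\<bar> \<le> B" using abs_le_block_norm norm by (meson order_trans)
        then show ?thesis by auto
      qed
      then show "y \<in> {1..?n} \<rightarrow>\<^sub>E {-B..B}" using y by (auto simp: PiE_def)
    qed
    moreover have "finite ({1..?n} \<rightarrow>\<^sub>E {-B..B})" by (simp add: finite_PiE)
    ultimately show ?thesis by (rule finite_subset)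
  qed
  \<comment> \<open>Keeping one zero \<open>z\<close> fixed, each splitting of \<open>g ?a\<close>
    into \<open>u\<close> and \<open>g ?a - u\<close> comes from a root, and distinct
    \<open>u\<close> need distinct roots. This gives at least \<open>g ?a + 1\<close> roots.\<close>
  have "{..g ?a} \<subseteq> (\<lambda>y. nat (block_norm y 0)) ` ?Z"
  proof
    fix u assume "u \<in> {..g ?a}"
    have "[?a, g ?a] \<in> graph_pos g" using a unfolding graph_pos_def by blast
    then obtain z where z: "z \<in> zeros m W [?a, g ?a]" using rep by blast
    then have len: "length z = m" by (simp add: zeros_def)
    obtain y where y: "\<And>j. j < m + 2 \<Longrightarrow> block_norm y j = int ((u # (g ?a - u) # z) ! j)"
      "y \<in> {1..?n} \<rightarrow>\<^sub>E UNIV"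
      using exists_block_norms[of "m + 2" "(!) (u # (g ?a - u) # z)"] by blast
    have "x y = z" using len y(1) unfolding x_def by (auto intro!: nth_equalityI)
    moreover have "b y = g ?a" using y(1)[of 0] y(1)[of 1] \<open>u \<in> {..g ?a}\<close> unfolding b_def by simp
    ultimately have "y \<in> ?Z" using y(2) z val_e by simp
    moreover have "u = nat (block_norm y 0)" using y(1)[of 0] by simp
    ultimately show "u \<in> (\<lambda>y. nat (block_norm y 0)) ` ?Z"
      by (rule rev_image_eqI[where f = "\<lambda>y. nat (block_norm y 0)"])
  qed
  then have "card {..g ?a} \<le> card ?Z" using finite_Z by (rule surj_card_le[rotated])
  then have "g ?a < card ?Z" by simp
  moreover obtain N where N: "1 \<le> N" "N \<le> ?n + nodes e" "card ?Z \<le> max_finite_solutions N"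
    using card_roots_le_max_finite_solutions[OF evars_e finite_Z] .
  moreover have "max_finite_solutions N \<le> g N" using assms(3) N(1) .
  \<comment> \<open>Monotonicity applies because the choice of \<open>t\<close> ensures
    \<open>N \<le> ?a\<close>.\<close>
  moreover have "g N \<le> g ?a"
    using assms(2) by (rule mono_onD) (use N size in auto)
  ultimately show False by linarith
qed

end
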